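(* Let $m$ be an integer and $n$ a nonnegative integer. Then the generalized Bernoulli numbers $B_n^{(m)}$ and the Bernoulli numbers $B_i$ satisfy $$\frac{1}{n!}B_{n}^{(m)}=\sum_{\substack{k_1+k_2+\cdots+k_n=l \\ k_1+2k_2+\cdots+nk_n=n}}\binom{m}{l}\frac{l!}{k_1!k_2!\cdots k_n!}\prod_{i=1}^{n}\left(\frac{1}{i!}B_{i}\right)^{k_{i}}.$$
   Context: For any integer $m$, the generalized Bernoulli numbers $B_n^{(m)}$ are defined by the formal power series identity $\left(1+\sum_{n\geq 1}\frac{1}{(n+1)!}X^{n}\right)^{-m}=1+\sum_{n\geq 1}\frac{1}{n!}B_{n}^{(m)}X^{n}$, with $B_0^{(m)}=1$; the Bernoulli numbers are $B_n=B_n^{(1)}$. The sum runs over all tuples of nonnegative integers $(k_1,\ldots,k_n)$ with $k_1+2k_2+\cdots+nk_n=n$, where $l=k_1+\cdots+k_n$ (for $n=0$ there is only the empty tuple, with $l=0$). Binomial coefficients are generalized: $\binom{x}{l}=x(x-1)\cdots(x-l+1)/l!$ for any integer $x$ and $l\ge0$. *)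

theory Defs
  imports "HOL-Computational_Algebra.Formal_Power_Series" "HOL-Library.FuncSet"
begin

text \<open>The series $1 + \sum_{n \ge 1} X^n / (n+1)!$, that is, $(e^X - 1)/X$.\<close>

definition expm1_quot_fps :: "rat fps" where
  "expm1_quot_fps = 1 + Abs_fps (\<lambda>n. if n = 0 then 0 else 1 / fact (n + 1))"

definition gen_bernoulli :: "int \<Rightarrow> nat \<Rightarrow> rat" where
  "gen_bernoulli m n = fact n * fps_nth (expm1_quot_fps powi (- m)) n"

definition bernoulli :: "nat \<Rightarrow> rat" where
  "bernoulli = gen_bernoulli 1"

text \<open>
  The inverse in \<^const>\<open>power_int\<close> is total on power series; the first two facts below confirm
  that it is a true inverse here, and the remaining ones that the coefficients are the intended
  ones.
\<close>

lemma expm1_quot_fps_nth_0: "fps_nth expm1_quot_fps 0 = 1"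
  by (simp add: expm1_quot_fps_def)

lemma expm1_quot_fps_inverse: "expm1_quot_fps * inverse expm1_quot_fps = 1"
  by (simp add: inverse_mult_eq_1' expm1_quot_fps_nth_0)

lemma gen_bernoulli_generating_function:
  "expm1_quot_fps powi (- m) = Abs_fps (\<lambda>n. gen_bernoulli m n / fact n)"
  by (simp add: fps_eq_iff gen_bernoulli_def)

lemma gen_bernoulli_0: "gen_bernoulli m 0 = 1"
  by (simp add: gen_bernoulli_def power_int_def fps_power_zeroth expm1_quot_fps_nth_0)

text \<open>
  Tuples $(k_1, \ldots, k_n)$ of natural numbers are functions on \<open>{1..n}\<close>, extended by
  \<^const>\<open>undefined\<close> outside so that each tuple is represented exactly once. For \<open>n = 0\<close>
  there is exactly one such function.
\<close>

definition weighted_tuples :: "nat \<Rightarrow> (nat \<Rightarrow> nat) set" where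
  "weighted_tuples n = {k \<in> {1..n} \<rightarrow>\<^sub>E UNIV. (\<Sum>i=1..n. i * k i) = n}"

lemma finite_weighted_tuples: "finite (weighted_tuples n)"
proof (rule finite_subset)
  show "weighted_tuples n \<subseteq> {1..n} \<rightarrow>\<^sub>E {..n}"
  proof
    fix k assume k: "k \<in> weighted_tuples n"
    have "k i \<le> n" if i: "i \<in> {1..n}" for i
    proof -
      have "k i \<le> i * k i" using i by simp
      also have "\<dots> \<le> (\<Sum>i=1..n. i * k i)"
        using i by (intro member_le_sum) auto
      also have "\<dots> = n" using k by (simp add: weighted_tuples_def)
      finally show ?thesis .
    qed
    with k show "k \<in> {1..n} \<rightarrow>\<^sub>E {..n}"
      by (auto simp: weighted_tuples_def PiE_iff)
  qed
  show "finite ({1..n} \<rightarrow>\<^sub>E {..n})"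
    by (intro finite_PiE) auto
qed

end

theory Submission
  imports Defs
begin

text \<open>
  Write \<open>A = (e\<^sup>X - 1)/X\<close> and \<open>A\<^sup>-\<^sup>1 = 1 + f\<close>, so that \<open>f\<close> has constant summand \<open>0\<close> and its
  coefficients of positive index are the \<open>B\<^sub>i / i!\<close>.  The number \<open>B\<^sub>n\<^sup>(\<^sup>m\<^sup>) / n!\<close> is the \<open>n\<close>-th
  coefficient of \<open>A\<^sup>-\<^sup>m = (1 + f)\<^sup>m\<close>, and Newton's binomial series, into which \<open>f\<close> may be
  substituted for \<open>X\<close>, expands this as the sum over \<open>l\<close> of \<open>(m choose l)\<close> times \<open>f\<^sup>l\<close>, for negative
  \<open>m\<close> as well (\<open>fps_binomial_of_int_compose\<close>).

  It remains to read off the \<open>n\<close>-th coefficient of \<open>f\<^sup>l\<close>.  Only the coefficients of \<open>f\<close> up to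
  index \<open>n\<close> matter, so \<open>f\<close> may be replaced by a polynomial, whose power is expanded by the
  multinomial theorem (\<open>multinomial_theorem\<close>): a choice of exponents \<open>k\<^sub>i\<close> with sum \<open>l\<close> contributes
  a multiple of \<open>X\<close> to the power \<open>k\<^sub>1 + 2 k\<^sub>2 + \<dots> + n k\<^sub>n\<close>, and this exponent has to be \<open>n\<close>
  (\<open>fps_power_nth_multinomial\<close>).  Every tuple of weight \<open>n\<close> has \<open>l \<le> n\<close>, so grouping the weighted
  tuples by \<open>l\<close> recovers exactly the double sum.
\<close>

definition tuples_of_sum :: "'i set \<Rightarrow> nat \<Rightarrow> ('i \<Rightarrow> nat) set" where
  "tuples_of_sum I l = {k \<in> I \<rightarrow>\<^sub>E UNIV. sum k I = l}"

lemma finite_tuples_of_sum: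
  assumes "finite I"
  shows "finite (tuples_of_sum I l)"
proof (rule finite_subset)
  show "tuples_of_sum I l \<subseteq> I \<rightarrow>\<^sub>E {..l}"
    using assms by (auto simp: tuples_of_sum_def PiE_iff extensional_def intro: member_le_sum)
  show "finite (I \<rightarrow>\<^sub>E {..l})"
    using assms by (intro finite_PiE) auto
qed

text \<open>
  This makes the quotient in the multinomial coefficient below an exact division in \<open>nat\<close>.
\<close>

lemma prod_fact_dvd_fact_sum:
  "finite I \<Longrightarrow> (\<Prod>i\<in>I. fact (k i)) dvd (fact (\<Sum>i\<in>I. k i) :: nat)"
proof (induction I rule: finite_induct)
  case (insert a I)
  have "fact (k a) * (\<Prod>i\<in>I. fact (k i)) dvd (fact (k a) * fact (\<Sum>i\<in>I. k i) :: nat)"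
    using insert.IH by (intro mult_dvd_mono) auto
  also have "\<dots> dvd fact (k a + (\<Sum>i\<in>I. k i))"
    by (rule fact_fact_dvd_fact)
  finally show ?case using insert.hyps by simp
qed simp

text \<open>
  The coefficient is a quotient of natural numbers so that the theorem makes sense in every
  commutative semiring, in particular in one of power series.  Splitting off one summand with
  the binomial theorem gives the inductive step.
\<close>

theorem multinomial_theorem:
  fixes y :: "'i \<Rightarrow> 'a :: comm_semiring_1"
  assumes "finite I"
  shows "(\<Sum>i\<in>I. y i) ^ l =
    (\<Sum>k\<in>tuples_of_sum I l. of_nat (fact l div (\<Prod>i\<in>I. fact (k i))) * (\<Prod>i\<in>I. y i ^ k i))"
  using assms
proof (induction I arbitrary: l rule: finite_induct)
  case empty
  show ?case by (cases l) (auto simp: tuples_of_sum_def)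
next
  case (insert a I)
  define summand where "summand J l k =
    (of_nat (fact l div (\<Prod>i\<in>J. fact (k i))) * (\<Prod>i\<in>J. y i ^ k i) :: 'a)" for J l and k :: "'i \<Rightarrow> nat"
  have upd: "(if i = a then j else g i) = g i" if "i \<in> I" for i j and g :: "'i \<Rightarrow> nat"
    using that insert.hyps by auto
  have step: "of_nat (l choose j) * y a ^ j * summand I (l - j) g = summand (insert a I) l (g(a := j))"
    if j: "j \<le> l" and g: "g \<in> tuples_of_sum I (l - j)" for j g
  proof -
    \<comment> \<open>The multinomial coefficient of the extended tuple factors as a binomial coefficient times
      the multinomial coefficient of the tuple on \<open>I\<close>.\<close>
    let ?P = "\<Prod>i\<in>I. fact (g i) :: nat"
    have dvd: "?P dvd fact (l - j)"
      using prod_fact_dvd_fact_sum[of I g] insert.hyps g by (simp add: tuples_of_sum_def)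
    have nonzero: "fact j * ?P \<noteq> 0"
      using insert.hyps by simp
    have "fact l = (fact j * ?P) * ((l choose j) * (fact (l - j) div ?P))"
      using binomial_fact_lemma[OF j] dvd by (auto simp: algebra_simps)
    then have "fact l div (fact j * ?P) = (l choose j) * (fact (l - j) div ?P)"
      using nonzero by (metis nonzero_mult_div_cancel_left)
    moreover have "(\<Prod>i\<in>I. fact ((g(a := j)) i)) = ?P"
      "(\<Prod>i\<in>I. y i ^ (g(a := j)) i) = (\<Prod>i\<in>I. y i ^ g i)"
      by (auto intro!: prod.cong simp: upd)
    ultimately show ?thesis
      using insert.hyps by (simp add: summand_def algebra_simps)
  qed
  have "(\<Sum>i\<in>insert a I. y i) ^ l = (y a + (\<Sum>i\<in>I. y i)) ^ l"
    using insert.hyps by simp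
  also have "\<dots> = (\<Sum>j\<le>l. \<Sum>g\<in>tuples_of_sum I (l - j).
      of_nat (l choose j) * y a ^ j * summand I (l - j) g)"
    by (simp add: binomial_ring insert.IH summand_def sum_distrib_left)
  also have "\<dots> = (\<Sum>j\<le>l. \<Sum>g\<in>tuples_of_sum I (l - j). summand (insert a I) l (g(a := j)))"
    by (intro sum.cong refl step) auto
  also have "\<dots> = (\<Sum>(j, g)\<in>(SIGMA j:{..l}. tuples_of_sum I (l - j)).
      summand (insert a I) l (g(a := j)))"
    by (intro sum.Sigma) (auto intro: finite_tuples_of_sum insert.hyps)
  also have "\<dots> = (\<Sum>k\<in>tuples_of_sum (insert a I) l. summand (insert a I) l k)"
  proof (rule sum.reindex_bij_witness[where i = "\<lambda>k. (k a, k(a := undefined))"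
        and j = "\<lambda>(j, g). g(a := j)"])
    fix p assume p: "p \<in> (SIGMA j:{..l}. tuples_of_sum I (l - j))"
    obtain j g where [simp]: "p = (j, g)" by fastforce
    have jg: "j \<le> l" "g \<in> I \<rightarrow>\<^sub>E UNIV" "sum g I = l - j"
      using p by (auto simp: tuples_of_sum_def)
    have "sum (g(a := j)) I = sum g I"
      by (intro sum.cong) (auto simp: upd)
    with jg show "(\<lambda>(j, g). g(a := j)) p \<in> tuples_of_sum (insert a I) l"
      using insert.hyps by (auto simp: tuples_of_sum_def PiE_iff extensional_def)
    show "(((\<lambda>(j, g). g(a := j)) p) a, ((\<lambda>(j, g). g(a := j)) p)(a := undefined)) = p"
      using jg insert.hyps by (auto simp: PiE_iff extensional_def)
    show "summand (insert a I) l ((\<lambda>(j, g). g(a := j)) p) =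
      (case p of (j, g) \<Rightarrow> summand (insert a I) l (g(a := j)))"
      by simp
  next
    fix k assume k: "k \<in> tuples_of_sum (insert a I) l"
    have "sum (k(a := undefined)) I = sum k I"
      by (intro sum.cong) (auto simp: upd)
    with k show "(k a, k(a := undefined)) \<in> (SIGMA j:{..l}. tuples_of_sum I (l - j))"
      using insert.hyps by (auto simp: tuples_of_sum_def PiE_iff extensional_def)
    show "(\<lambda>(j, g). g(a := j)) (k a, k(a := undefined)) = k"
      by simp
  qed
  finally show ?case by (simp add: summand_def)
qed

lemma fps_power_nth_cong:
  assumes "\<And>i. i \<le> n \<Longrightarrow> fps_nth f i = fps_nth g i"
  shows "fps_nth (f ^ l) n = fps_nth (g ^ l) n"
  using assms
proof (induction l arbitrary: n)
  case (Suc l)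
  then show ?case by (auto simp: fps_mult_nth intro!: sum.cong)
qed simp

text \<open>
  As \<open>f\<close> has no constant term, the polynomial \<open>f\<^sub>1 X + \<dots> + f\<^sub>n X\<^sup>n\<close> agrees with \<open>f\<close> up to index \<open>n\<close>.
  In the multinomial expansion of its \<open>l\<close>-th power each tuple contributes a single monomial, whose
  degree is the weight of the tuple.
\<close>

lemma fps_power_nth_multinomial:
  fixes f :: "'a :: field_char_0 fps"
  assumes f0: "fps_nth f 0 = 0"
  shows "fps_nth (f ^ l) n = (\<Sum>k | k \<in> weighted_tuples n \<and> (\<Sum>i=1..n. k i) = l.
    fact l / (\<Prod>i=1..n. fact (k i)) * (\<Prod>i=1..n. fps_nth f i ^ k i))"
proof -
  let ?y = "\<lambda>i. fps_const (fps_nth f i) * fps_X ^ i"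
  let ?T = "tuples_of_sum {1..n} l"
  have monomial: "(\<Prod>i=1..n. ?y i ^ k i) =
      fps_const (\<Prod>i=1..n. fps_nth f i ^ k i) * fps_X ^ (\<Sum>i=1..n. i * k i)" for k
  proof -
    have "(\<Prod>i\<in>I. ?y i ^ k i) =
      fps_const (\<Prod>i\<in>I. fps_nth f i ^ k i) * fps_X ^ (\<Sum>i\<in>I. i * k i)" for I
      by (induction I rule: infinite_finite_induct)
        (simp_all add: power_mult_distrib power_add power_mult fps_const_power mult_ac
          flip: fps_const_mult)
    then show ?thesis .
  qed
  have coeff: "of_nat (fact l div (\<Prod>i=1..n. fact (k i))) =
      (fact l / (\<Prod>i=1..n. fact (k i)) :: 'a)" if "k \<in> ?T" for k
    using prod_fact_dvd_fact_sum[of "{1..n}" k] that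
    by (simp add: tuples_of_sum_def of_nat_of_nat_div)
  have "fps_nth (f ^ l) n = fps_nth ((\<Sum>i=1..n. ?y i) ^ l) n"
    by (rule fps_power_nth_cong) (auto simp: fps_sum_nth mult_delta_right f0 Suc_le_eq)
  also have "\<dots> = (\<Sum>k\<in>?T. if (\<Sum>i=1..n. i * k i) = n
      then fact l / (\<Prod>i=1..n. fact (k i)) * (\<Prod>i=1..n. fps_nth f i ^ k i) else 0)"
    by (auto simp: multinomial_theorem fps_sum_nth monomial coeff fps_of_nat[symmetric]
        simp del: One_nat_def fps_of_nat intro!: sum.cong)
  also have "\<dots> = (\<Sum>k | k \<in> ?T \<and> (\<Sum>i=1..n. i * k i) = n.
      fact l / (\<Prod>i=1..n. fact (k i)) * (\<Prod>i=1..n. fps_nth f i ^ k i))"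
    by (rule sum.inter_filter[symmetric]) (simp add: finite_tuples_of_sum)
  also have "{k. k \<in> ?T \<and> (\<Sum>i=1..n. i * k i) = n} =
      {k. k \<in> weighted_tuples n \<and> (\<Sum>i=1..n. k i) = l}"
    by (auto simp: tuples_of_sum_def weighted_tuples_def)
  finally show ?thesis .
qed

text \<open>
  Newton's series with a natural or negated natural exponent is \<open>(1 + X)\<^sup>j\<close> or its inverse, and
  substituting a series without constant term for \<open>X\<close> commutes with powers and inverses.
\<close>

lemma fps_binomial_of_int_compose:
  fixes f :: "'a :: field_char_0 fps"
  assumes f0: "fps_nth f 0 = 0"
  shows "fps_compose (fps_binomial (of_int m)) f = (1 + f) powi m"
proof -
  have pow: "fps_compose ((1 + fps_X) ^ j) f = (1 + f) ^ j" for j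
    using f0 by (simp add: fps_compose_power[symmetric] fps_compose_add_distrib)
  show ?thesis
  proof (cases "m \<ge> 0")
    case True
    then have "of_int m = (of_nat (nat m) :: 'a)" by simp
    with True show ?thesis
      by (simp only: fps_binomial_of_nat pow) (simp add: power_int_def)
  next
    case False
    then have "of_int m = (- of_nat (nat (- m)) :: 'a)" by simp
    with False show ?thesis
      using f0 by (simp only: fps_binomial_minus_of_nat)
        (simp add: fps_inverse_compose fps_power_zeroth pow power_int_def
          flip: fps_inverse_power)
  qed
qed

theorem theorem2p4:
  fixes m :: int and n :: nat
  shows "gen_bernoulli m n / fact n =
    (\<Sum>k\<in>weighted_tuples n.
       let l = (\<Sum>i=1..n. k i) in
         (of_int m gchoose l) * (fact l / (\<Prod>i=1..n. fact (k i))) *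
         (\<Prod>i=1..n. (bernoulli i / fact i) ^ k i))"
proof -
  define f where "f = inverse expm1_quot_fps - 1"
  have f0: "fps_nth f 0 = 0"
    by (simp add: f_def expm1_quot_fps_nth_0)
  have f_nth: "fps_nth f i = bernoulli i / fact i" if "i \<in> {1..n}" for i
    using that by (simp add: f_def bernoulli_def gen_bernoulli_def power_int_def)
  have le: "(\<Sum>i=1..n. k i) \<le> n" if "k \<in> weighted_tuples n" for k
  proof -
    have "(\<Sum>i=1..n. k i) \<le> (\<Sum>i=1..n. i * k i)"
      by (intro sum_mono) simp
    with that show ?thesis by (simp add: weighted_tuples_def)
  qed
  let ?t = "\<lambda>l k. (of_int m gchoose l) * (fact l / (\<Prod>i=1..n. fact (k i))) *
    (\<Prod>i=1..n. (bernoulli i / fact i) ^ k i)"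
  \<comment> \<open>A negative power of \<open>A\<^sup>-\<^sup>1\<close> involves the inverse of \<open>A\<^sup>-\<^sup>1\<close>, which is \<open>A\<close> as its constant
    term is nonzero.\<close>
  have "expm1_quot_fps powi (- m) = (1 + f) powi m"
    using expm1_quot_fps_nth_0
    by (cases m "0 :: int" rule: linorder_cases) (simp_all add: f_def power_int_def)
  then have "gen_bernoulli m n / fact n = fps_nth (fps_compose (fps_binomial (of_int m)) f) n"
    by (simp add: gen_bernoulli_def fps_binomial_of_int_compose f0)
  also have "\<dots> = (\<Sum>l=0..n. (of_int m gchoose l) * fps_nth (f ^ l) n)"
    by (simp add: fps_compose_nth fps_binomial_def)
  also have "\<dots> = (\<Sum>l=0..n. \<Sum>k | k \<in> weighted_tuples n \<and> (\<Sum>i=1..n. k i) = l. 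
      ?t (\<Sum>i=1..n. k i) k)"
    by (auto simp: fps_power_nth_multinomial[OF f0] sum_distrib_left f_nth mult.assoc
        intro!: sum.cong)
  also have "\<dots> = (\<Sum>k\<in>weighted_tuples n. ?t (\<Sum>i=1..n. k i) k)"
    using le by (intro sum.group) (auto simp: finite_weighted_tuples)
  finally show ?thesis by (simp add: Let_def)
qed

end
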